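(* Let $m$ be a positive integer, let $M_1,\dots,M_{m-1}\ge 0$ and let $\Lambda$ be a real number. Let $F(z)=\sum_{k=0}^{m-1}\bar z^k f_k(z)$ be a poly-analytic function of order $m$ on $\mathbb{D}$, where all $f_k$ are holomorphic on $\mathbb{D}$, satisfying $f_k(0)=0$ for $k\in\{0,1,\dots,m-1\}$ and $F_z(0)=1$. Suppose that $|f_0'(z)|<\Lambda$ and $|f_k(z)|\le M_k$ for $k\in\{1,\dots,m-1\}$, for all $z\in\mathbb{D}$. Let $r_1$ be the unique root in $(0,1)$ of the equation $$\frac{\Lambda(1-\Lambda r)}{\Lambda-r}-\sum_{k=1}^{m-1}r^k\left(\frac{M_k}{1-r^2}+kM_k\right)=0.$$ Then for each $\rho_1\in(0,r_1)$, the function $F$ is bi-Lipschitz on $\overline{\mathbb{D}}_{\rho_1}$.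
   Context: $\mathbb{D}=\{z\in\mathbb{C}:|z|<1\}$, $\mathbb{D}_r=\{z\in\mathbb{C}:|z|<r\}$, and $\overline{\mathbb{D}}_r$ is its closure. A complex-valued $C^m$ function $F$ on a domain is poly-analytic of order $m\ge1$ if $\partial^m F/\partial\bar z^m=0$; equivalently $F(z)=\sum_{k=0}^{m-1}\bar z^k f_k(z)$ with $f_k$ analytic. $F_z=\partial F/\partial z$ is the Wirtinger derivative. A map $g$ on $\Omega\subset\mathbb{C}$ is bi-Lipschitz if there are constants $l,L>0$ with $l|z_1-z_2|\le|g(z_1)-g(z_2)|\le L|z_1-z_2|$ for all $z_1,z_2\in\Omega$. Under the stated hypotheses $\Lambda>1$ and the root $r_1$ exists and is unique. Empty sums are $0$. *)

theory Defs
  imports "HOL-Complex_Analysis.Complex_Analysis"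
begin

text \<open>
  The derivatives below are those of \<open>F\<close> as a function of two real variables:
  \<open>frechet_derivative F (at z) 1\<close> and \<open>frechet_derivative F (at z) \<i>\<close> are the partial derivatives
  in \<open>x\<close> and \<open>y\<close>, where \<open>z = x + \<i> y\<close>.
\<close>

definition wirtinger_z :: "(complex \<Rightarrow> complex) \<Rightarrow> complex \<Rightarrow> complex" where
  "wirtinger_z F z =
     (frechet_derivative F (at z) 1 - \<i> * frechet_derivative F (at z) \<i>) / 2"

definition wirtinger_zbar :: "(complex \<Rightarrow> complex) \<Rightarrow> complex \<Rightarrow> complex" where
  "wirtinger_zbar F z =
     (frechet_derivative F (at z) 1 + \<i> * frechet_derivative F (at z) \<i>) / 2"

text \<open>Real \<open>C\<^sup>n\<close> smoothness on an open subset of the plane.\<close>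

primrec C_on :: "nat \<Rightarrow> complex set \<Rightarrow> (complex \<Rightarrow> complex) \<Rightarrow> bool" where
  "C_on 0 S F \<longleftrightarrow> continuous_on S F"
| "C_on (Suc n) S F \<longleftrightarrow>
     (\<forall>z\<in>S. F differentiable (at z)) \<and>
     C_on n S (\<lambda>z. frechet_derivative F (at z) 1) \<and>
     C_on n S (\<lambda>z. frechet_derivative F (at z) \<i>)"

definition polyanalytic_on :: "nat \<Rightarrow> complex set \<Rightarrow> (complex \<Rightarrow> complex) \<Rightarrow> bool" where
  "polyanalytic_on m S F \<longleftrightarrow> C_on m S F \<and> (\<forall>z\<in>S. (wirtinger_zbar ^^ m) F z = 0)"

definition bi_lipschitz_on :: "complex set \<Rightarrow> (complex \<Rightarrow> complex) \<Rightarrow> bool" where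
  "bi_lipschitz_on S g \<longleftrightarrow>
     (\<exists>l L. l > 0 \<and> L > 0 \<and>
        (\<forall>z1\<in>S. \<forall>z2\<in>S. l * norm (z1 - z2) \<le> norm (g z1 - g z2) \<and>
                         norm (g z1 - g z2) \<le> L * norm (z1 - z2)))"

text \<open>
  Sanity check: a function with an expansion \<open>\<Sum>k<m. cnj z ^ k * f k z\<close>, with \<open>f k\<close> holomorphic on an
  open set, is poly-analytic of order \<open>m\<close> there in the sense above, so a theorem that assumes the
  expansion may add poly-analyticity to its hypotheses without losing generality.
\<close>

lemma frechet_derivative_eqI:
  assumes "open S" "z \<in> S" "\<And>w. w \<in> S \<Longrightarrow> F w = G w" "(G has_derivative D) (at z)"
  shows "F differentiable (at z)" "frechet_derivative F (at z) = D"
proof -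
  have "(F has_derivative D) (at z)"
    using has_derivative_transform_within_open[OF assms(4,1,2)] assms(3) by metis
  then show "F differentiable (at z)" "frechet_derivative F (at z) = D"
    by (auto simp: differentiable_def frechet_derivative_at[symmetric])
qed

lemma has_derivative_expansion:
  assumes S: "open S" "z \<in> S" and f: "\<And>k. k < m \<Longrightarrow> f k holomorphic_on S"
  shows "((\<lambda>z. \<Sum>k<m. cnj z ^ k * f k z) has_derivative
          (\<lambda>h. (\<Sum>k<m. cnj z ^ k * deriv (f k) z) * h
             + (\<Sum>k<m. of_nat k * cnj z ^ (k - 1) * f k z) * cnj h)) (at z)"
proof -
  have f': "(f k has_derivative (\<lambda>h. deriv (f k) z * h)) (at z)" if "k < m" for k
    using holomorphic_derivI[OF f[OF that] S, of UNIV] by (simp add: has_field_derivative_def)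
  have c: "(cnj has_derivative cnj) (at z)"
    using bounded_linear_imp_has_derivative[OF bounded_linear_cnj] .
  have "((\<lambda>z. \<Sum>k<m. cnj z ^ k * f k z) has_derivative
          (\<lambda>h. \<Sum>k<m. cnj z ^ k * (deriv (f k) z * h) + (of_nat k * cnj h * cnj z ^ (k - 1)) * f k z)) (at z)"
    by (intro has_derivative_sum has_derivative_mult has_derivative_power c f') auto
  then show ?thesis
    by (rule has_derivative_eq_rhs)
       (auto simp: sum.distrib sum_distrib_left sum_distrib_right algebra_simps fun_eq_iff)
qed

lemma polyanalytic_on_expansion:
  assumes S: "open S" and f: "\<And>k. k < m \<Longrightarrow> f k holomorphic_on S"
    and F: "\<And>z. z \<in> S \<Longrightarrow> F z = (\<Sum>k<m. cnj z ^ k * f k z)"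
  shows "polyanalytic_on m S F"
proof -
  have shift: "(\<Sum>k<m. of_nat k * cnj z ^ (k - 1) * g k z)
             = (\<Sum>k<m. cnj z ^ k * (if Suc k < m then of_nat (Suc k) * g (Suc k) z else 0))"
    for g :: "nat \<Rightarrow> complex \<Rightarrow> complex" and z m
  proof (cases m)
    case (Suc n)
    have "(\<Sum>k<Suc n. of_nat k * cnj z ^ (k - 1) * g k z)
        = (\<Sum>k<n. cnj z ^ k * (of_nat (Suc k) * g (Suc k) z))"
      by (subst sum.lessThan_Suc_shift) (simp add: ac_simps del: of_nat_Suc sum.lessThan_Suc)
    also have "\<dots> = (\<Sum>k<Suc n. cnj z ^ k * (if Suc k < Suc n then of_nat (Suc k) * g (Suc k) z else 0))"
      by (simp del: of_nat_Suc)
    finally show ?thesis unfolding Suc .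
  qed simp
  have C: "C_on n S F" if "\<And>k. k < m \<Longrightarrow> f k holomorphic_on S"
      "\<And>z. z \<in> S \<Longrightarrow> F z = (\<Sum>k<m. cnj z ^ k * f k z)" for n F and f :: "nat \<Rightarrow> complex \<Rightarrow> complex"
    using that
  proof (induction n arbitrary: F f)
    case 0
    have "continuous_on S (\<lambda>z. \<Sum>k<m. cnj z ^ k * f k z)"
      using 0(1) by (intro continuous_intros holomorphic_on_imp_continuous_on) auto
    then show ?case using 0(2) by (simp cong: continuous_on_cong)
  next
    case (Suc n)
    note D = frechet_derivative_eqI[OF S _ Suc.prems(2)
        has_derivative_expansion[OF S _ Suc.prems(1)]]
    let ?g = "\<lambda>k z. if Suc k < m then of_nat (Suc k) * f (Suc k) z else 0"
    have hol: "(\<lambda>z. deriv (f k) z * c + ?g k z * d) holomorphic_on S" if "k < m" for k c d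
      using Suc.prems(1) that S by (cases "Suc k < m") (auto intro!: holomorphic_intros)
    have "C_on n S (\<lambda>z. frechet_derivative F (at z) h)" for h
    proof (rule Suc.IH[OF hol[where c = h and d = "cnj h"]])
      fix z assume z: "z \<in> S"
      show "frechet_derivative F (at z) h =
              (\<Sum>k<m. cnj z ^ k * (deriv (f k) z * h + ?g k z * cnj h))"
        using D(2)[OF z] z by (simp only: shift) (simp add: algebra_simps sum.distrib sum_distrib_left sum_distrib_right)
    qed
    then show ?case using D(1) by simp
  qed
  have Z: "\<forall>z\<in>S. (wirtinger_zbar ^^ m) F z = 0" if "\<And>k. k < m \<Longrightarrow> f k holomorphic_on S"
      "\<And>z. z \<in> S \<Longrightarrow> F z = (\<Sum>k<m. cnj z ^ k * f k z)" for m F and f :: "nat \<Rightarrow> complex \<Rightarrow> complex"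
    using that
  proof (induction m arbitrary: F f)
    case 0
    then show ?case by simp
  next
    case (Suc m)
    note D = frechet_derivative_eqI[OF S _ Suc.prems(2)
        has_derivative_expansion[OF S _ Suc.prems(1)]]
    have "wirtinger_zbar F z = (\<Sum>k<m. cnj z ^ k * (of_nat (Suc k) * f (Suc k) z))"
      if z: "z \<in> S" for z
    proof -
      have "wirtinger_zbar F z = (\<Sum>k<Suc m. of_nat k * cnj z ^ (k - 1) * f k z)"
        unfolding wirtinger_zbar_def using D(2)[OF z] z
        by (simp add: algebra_simps del: sum.lessThan_Suc)
      then show ?thesis
        by (simp add: sum.lessThan_Suc_shift algebra_simps del: of_nat_Suc sum.lessThan_Suc)
    qed
    moreover have "(\<lambda>z. of_nat (Suc k) * f (Suc k) z) holomorphic_on S" if "k < m" for k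
      using Suc.prems(1) that by (intro holomorphic_intros) auto
    ultimately show ?case
      using Suc.IH[of "\<lambda>k z. of_nat (Suc k) * f (Suc k) z" "wirtinger_zbar F"]
      by (simp add: funpow_swap1 del: of_nat_Suc)
  qed
  show ?thesis unfolding polyanalytic_on_def using C[OF f F] Z[OF f F] by blast
qed

end

theory Submission imports Defs begin

text \<open>
  On the disc of radius \<open>r\<close>, the Schwarz lemma applied to a Moebius transform of \<open>f\<^sub>0' / \<Lambda>\<close> gives
  \<open>Re f\<^sub>0' \<ge> \<Lambda> (1 - \<Lambda> r) / (\<Lambda> - r)\<close>, hence \<open>f\<^sub>0\<close> expands distances by at least this factor. The
  Schwarz lemma and the Schwarz-Pick estimate bound \<open>f\<^sub>k\<close> and \<open>f\<^sub>k'\<close>, so that the remaining part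
  \<open>\<Sum>\<^sub>k\<^sub>\<ge>\<^sub>1 cnj z\<^sup>k f\<^sub>k\<close> is Lipschitz with the sum in the equation for \<open>r\<^sub>1\<close> as constant. The difference of
  the two constants is strictly decreasing in \<open>r\<close> and vanishes at \<open>r\<^sub>1\<close>, so it is positive before \<open>r\<^sub>1\<close>.
\<close>

section \<open>Schwarz and Schwarz-Pick estimates on the unit disc\<close>

text \<open>The classical Schwarz lemma asks for a strict bound by 1, whereas here the bound
  \<open>M\<close> is not strict and may be 0. Dividing by \<open>M + e\<close> with
  \<open>e > 0\<close> handles both, and \<open>e\<close> is arbitrary.\<close>

lemma Schwarz_Lemma_bound:
  assumes "f holomorphic_on ball 0 1" "f 0 = 0"
    and bd: "\<And>z. z \<in> ball 0 1 \<Longrightarrow> norm (f z) \<le> M" and z: "norm z < 1"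
  shows "norm (f z) \<le> M * norm z"
proof (rule field_le_epsilon)
  fix e :: real assume e: "e > 0"
  have M: "M \<ge> 0" using bd[of 0] norm_ge_zero[of "f 0"] by (simp add: assms(2))
  let ?M = "M + e"
  have "norm (f z / of_real ?M) \<le> norm z"
  proof (rule Schwarz_Lemma(1)[where f = "\<lambda>z. f z / of_real ?M"])
    show "(\<lambda>z. f z / of_real ?M) holomorphic_on ball 0 1"
      using assms(1) M e by (intro holomorphic_intros) (auto simp del: of_real_add)
    fix w :: complex assume "norm w < 1"
    then have "norm (f w) < ?M" using bd[of w] e by auto
    then show "norm (f w / of_real ?M) < 1"
      using M e by (simp add: norm_divide del: of_real_add)
  qed (use assms z in auto)
  then have "norm (f z) \<le> ?M * norm z"
    using M e by (simp add: norm_divide field_simps del: of_real_add)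
  also have "\<dots> \<le> M * norm z + e"
    using z e by (simp add: distrib_right)
  finally show "norm (f z) \<le> M * norm z + e" .
qed

text \<open>A disc automorphism \<open>T\<close> with \<open>T 0 = z\<close> has derivative
  \<open>1 - |z|^2\<close> at 0. The chain rule thus reduces the claim to the Cauchy estimate for
  \<open>f \<circ> T\<close> at the centre.\<close>

lemma Schwarz_Pick_deriv_bound:
  assumes hol: "f holomorphic_on ball 0 1"
    and bd: "\<And>z. z \<in> ball 0 1 \<Longrightarrow> norm (f z) \<le> M" and z: "norm z < 1"
  shows "norm (deriv f z) \<le> M / (1 - (norm z)\<^sup>2)"
proof -
  \<comment> \<open>Explicitly \<open>T x = (x + z) / (1 + cnj z * x)\<close>; the argument 0 is the
    rotation angle.\<close>
  define T where "T = Moebius_function 0 (- z)"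
  have z': "norm (- z) < 1" using z by simp
  have Tb: "T w \<in> ball 0 1" if "w \<in> ball 0 1" for w
    using Moebius_function_norm_lt_1[OF z'] that by (simp add: T_def)
  have Thol: "T holomorphic_on ball 0 1"
    unfolding T_def by (rule Moebius_function_holomorphic[OF z'])
  have T0: "T 0 = z" by (simp add: T_def Moebius_function_def)
  have hT: "(f \<circ> T) holomorphic_on ball 0 1"
    using Tb by (intro holomorphic_on_compose_gen[OF Thol hol]) auto
  have dT: "(T has_field_derivative 1 - of_real ((norm z)\<^sup>2)) (at 0)"
    unfolding T_def Moebius_function_def
    by (auto intro!: derivative_eq_intros simp: complex_norm_square simp del: of_real_power)
  have df: "(f has_field_derivative deriv f z) (at (T 0))"
    using hol z by (auto simp: T0 intro!: holomorphic_derivI[where S = "ball 0 1"])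
  have "deriv (f \<circ> T) 0 = deriv f z * (1 - of_real ((norm z)\<^sup>2))"
    using DERIV_imp_deriv[OF DERIV_chain[OF df dT]] .
  moreover have "norm (1 - of_real ((norm z)\<^sup>2) :: complex) = 1 - (norm z)\<^sup>2"
  proof -
    have "norm (of_real (1 - (norm z)\<^sup>2) :: complex) = 1 - (norm z)\<^sup>2"
      using z by (subst norm_of_real) (simp add: power_le_one)
    then show ?thesis by simp
  qed
  ultimately have eq: "norm (deriv (f \<circ> T) 0) = norm (deriv f z) * (1 - (norm z)\<^sup>2)"
    by (simp add: norm_mult)
  \<comment> \<open>Cauchy's inequality needs continuity up to the boundary circle, so it is applied
    at radius \<open>r < 1\<close>, and \<open>r\<close> then tends to 1 from the left.\<close>
  have "norm (deriv (f \<circ> T) 0) * r \<le> M" if r: "0 < r" "r < 1" for r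
  proof -
    have sub: "cball 0 r \<subseteq> ball (0::complex) 1" using r by auto
    have "norm ((deriv ^^ 1) (f \<circ> T) 0) \<le> fact 1 * M / r ^ 1"
      using sub r Tb bd
      by (intro Cauchy_inequality holomorphic_on_subset[OF hT]
          continuous_on_subset[OF holomorphic_on_imp_continuous_on[OF hT]]) auto
    then show ?thesis using r by (simp add: field_simps)
  qed
  then have "norm (deriv (f \<circ> T) 0) * 1 \<le> M"
    by (intro tendsto_upperbound[where F = "at_left 1" and f = "\<lambda>r. norm (deriv (f \<circ> T) 0) * r"]
        tendsto_intros) (auto simp: eventually_at_left[of 0] intro!: exI[of _ 0])
  then show ?thesis
    using z by (simp add: eq field_simps abs_square_less_1)
qed

text \<open>Put \<open>a = 1/\<Lambda>\<close>. By Schwarz-Pick, \<open>g z / \<Lambda>\<close> lies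
  in the pseudo-hyperbolic disc of centre \<open>a\<close> and radius \<open>r\<close>. The point of
  least real part there is \<open>(a - r) / (1 - a * r)\<close>, and \<open>\<Lambda>\<close> times
  it is the bound.\<close>

lemma Re_ge_of_Schwarz_Pick:
  assumes hol: "g holomorphic_on ball 0 1" and g0: "g 0 = 1"
    and bd: "\<And>z. z \<in> ball 0 1 \<Longrightarrow> norm (g z) < \<Lambda>"
    and z: "norm z \<le> r" and r: "r < 1"
  shows "\<Lambda> * (1 - \<Lambda> * r) / (\<Lambda> - r) \<le> Re (g z)"
proof -
  have L: "\<Lambda> > 1" using bd[of 0] by (simp add: g0)
  have r0: "0 \<le> r" using z norm_ge_zero order_trans by blast
  define a where "a = 1 / \<Lambda>"
  have a: "0 < a" "a < 1" using L by (auto simp: a_def)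
  have na: "norm (of_real a :: complex) < 1" using a by simp
  define w where "w z = g z / of_real \<Lambda>" for z
  define h where "h = Moebius_function 0 (of_real a) \<circ> w"
  have w1: "norm (w z) < 1" if "norm z < 1" for z
    using bd[of z] that L by (simp add: w_def norm_divide)
  have wh: "w holomorphic_on ball 0 1"
    unfolding w_def using hol L by (intro holomorphic_intros) auto
  have "h holomorphic_on ball 0 1"
    unfolding h_def using w1
    by (intro holomorphic_on_compose_gen[OF wh Moebius_function_holomorphic[OF na]]) auto
  moreover have "norm (h z) < 1" if "norm z < 1" for z
    unfolding h_def comp_def by (rule Moebius_function_norm_lt_1[OF na w1[OF that]])
  moreover have "h 0 = 0"
    by (simp add: h_def w_def g0 a_def Moebius_function_def)
  ultimately have "norm (h z) \<le> norm z"
    using z r by (intro Schwarz_Lemma(1)[where f = h]) auto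
  then have hz: "norm (h z) \<le> r" using z by simp
  define x y where "x = Re (w z)" and "y = Im (w z)"
  have wz: "norm (w z) < 1" using w1 z r by simp
  have "norm (of_real a * w z) < 1"
    using norm_mult_less[OF na wz] by simp
  then have nz: "1 - of_real a * w z \<noteq> 0" by auto
  have "norm (h z) = norm (w z - of_real a) / norm (1 - of_real a * w z)"
    by (simp add: h_def Moebius_function_def norm_divide)
  then have "norm (w z - of_real a) \<le> r * norm (1 - of_real a * w z)"
    using hz nz by (simp add: field_simps)
  then have "(norm (w z - of_real a))\<^sup>2 \<le> (r * norm (1 - of_real a * w z))\<^sup>2"
    by (intro power_mono) auto
  then have "(x - a)\<^sup>2 + y\<^sup>2 \<le> r\<^sup>2 * ((1 - a * x)\<^sup>2 + (a * y)\<^sup>2)"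
    by (simp add: power_mult_distrib cmod_power2 x_def y_def)
  \<comment> \<open>Since \<open>r * a \<le> 1\<close>, the imaginary part can be cancelled from
    both sides, leaving an inequality in \<open>x\<close> alone.\<close>
  moreover have "r\<^sup>2 * (a * y)\<^sup>2 \<le> y\<^sup>2"
  proof -
    have "r\<^sup>2 * a\<^sup>2 \<le> 1"
      using a r r0 by (intro mult_le_one power_le_one) auto
    then have "(r\<^sup>2 * a\<^sup>2) * y\<^sup>2 \<le> 1 * y\<^sup>2" by (rule mult_right_mono) simp
    then show ?thesis by (simp add: power_mult_distrib ac_simps)
  qed
  ultimately have "(x - a)\<^sup>2 \<le> (r * (1 - a * x))\<^sup>2"
    by (simp add: power_mult_distrib distrib_left)
  moreover have "0 \<le> r * (1 - a * x)"
  proof -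
    have "x < 1" using wz complex_Re_le_cmod[of "w z"] by (simp add: x_def)
    then have "a * x \<le> 1" using a by (smt (verit) mult_left_le mult_less_cancel_left_pos)
    then show ?thesis using r0 by simp
  qed
  ultimately have "\<bar>x - a\<bar> \<le> r * (1 - a * x)"
    by (metis abs_le_square_iff abs_of_nonneg)
  then have "a - r \<le> x * (1 - r * a)" by (simp add: algebra_simps)
  \<comment> \<open>This is the previous inequality multiplied by
    \<open>\<Lambda>\<^sup>2\<close>.\<close>
  then have "\<Lambda> * (1 - \<Lambda> * r) \<le> (\<Lambda> * x) * (\<Lambda> - r)"
    using L by (simp add: a_def field_simps)
  moreover have "\<Lambda> * x = Re (g z)" using L by (simp add: x_def w_def)
  ultimately show ?thesis using L r by (simp add: pos_divide_le_eq)
qed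

section \<open>Lower distance bound from the real part of the derivative\<close>

text \<open>A quantitative Noshiro-Warschawski argument. With \<open>u = z1 - z2\<close>, the real
  mean value theorem along the segment gives
  \<open>Re (cnj u * (f z1 - f z2)) = |u|^2 * Re (f' p)\<close> at some point \<open>p\<close> of
  it. The left side is at most \<open>|u| * |f z1 - f z2|\<close>, and \<open>|u|\<close>
  cancels.\<close>

lemma norm_diff_ge_of_Re_deriv_ge:
  assumes S: "convex S" and d: "\<And>z. z \<in> S \<Longrightarrow> (f has_field_derivative f' z) (at z within S)"
    and Re: "\<And>z. z \<in> S \<Longrightarrow> c \<le> Re (f' z)" and z: "z1 \<in> S" "z2 \<in> S"
  shows "c * norm (z1 - z2) \<le> norm (f z1 - f z2)"
proof (cases "z1 = z2")
  case False
  define u where "u = z1 - z2"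
  define p where "p t = z2 + of_real t * u" for t :: real
  define G where "G t = Re (cnj u * f (p t))" for t :: real
  have pS: "p t \<in> S" if "t \<in> {0..1}" for t
  proof -
    have "p t = (1 - t) *\<^sub>R z2 + t *\<^sub>R z1"
      by (simp add: p_def u_def scaleR_conv_of_real algebra_simps)
    then show ?thesis using convexD_alt[OF S z(2,1)] that by simp
  qed
  have dG: "(G has_derivative (\<lambda>s. s * Re (cnj u * (f' (p t) * u)))) (at t within {0..1})"
    if "t \<in> {0..1}" for t
  proof -
    have "(p has_vector_derivative u) (at t within {0..1})"
      unfolding p_def by (auto intro!: derivative_eq_intros simp: scaleR_conv_of_real)
    then have "((f \<circ> p) has_vector_derivative u * f' (p t)) (at t within {0..1})"
      using pS that by (intro field_vector_diff_chain_within DERIV_subset[OF d]) auto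
    then have "((\<lambda>t. Re (cnj u * (f \<circ> p) t)) has_vector_derivative Re (cnj u * (u * f' (p t)))) (at t within {0..1})"
      by (intro bounded_linear.has_vector_derivative[OF bounded_linear_Re] has_vector_derivative_mult_right)
    then show ?thesis
      by (simp add: has_vector_derivative_def G_def[abs_def] comp_def mult.commute)
  qed
  have "\<exists>t\<in>{0<..<1}. G 1 - G 0 = (1 - 0) * Re (cnj u * (f' (p t) * u))"
    using mvt_simple[of 0 1 G, OF zero_less_one dG] by simp
  then obtain t where "t \<in> {0<..<1}" "G 1 - G 0 = (1 - 0) * Re (cnj u * (f' (p t) * u))"
    by blast
  then have t: "t \<in> {0..1}" "G 1 - G 0 = Re (cnj u * (f' (p t) * u))"
    by simp_all
  \<comment> \<open>The factor \<open>cnj u * u\<close> is real, so it can be taken out of the real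
    part.\<close>
  have "cnj u * (f' (p t) * u) = of_real ((norm u)\<^sup>2) * f' (p t)"
    by (simp add: complex_norm_square ac_simps del: of_real_power)
  then have "G 1 - G 0 = (norm u)\<^sup>2 * Re (f' (p t))"
    unfolding t(2) by (simp only: times_complex.sel Re_complex_of_real Im_complex_of_real mult_zero_left diff_zero)
  then have "(norm u)\<^sup>2 * c \<le> G 1 - G 0"
    using Re[OF pS[OF t(1)]] by (simp add: mult_left_mono)
  also have "G 1 - G 0 = Re (cnj u * (f z1 - f z2))"
    by (simp add: G_def p_def u_def algebra_simps)
  also have "\<dots> \<le> norm u * norm (f z1 - f z2)"
    using complex_Re_le_cmod[of "cnj u * (f z1 - f z2)"] by (simp add: norm_mult)
  finally have "norm u * (c * norm u) \<le> norm u * norm (f z1 - f z2)"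
    by (simp add: power2_eq_square ac_simps)
  then show ?thesis using False by (simp add: u_def)
qed simp

section \<open>Monotonicity and the unique root of the radius equation\<close>

text \<open>Cross-multiplying the two fractions leaves the difference
  \<open>(t - s) * (\<Lambda>\<^sup>2 - 1) > 0\<close>, so the first term strictly decreases. The
  subtracted sum is nondecreasing term by term.\<close>

lemma radius_function_strict_antimono:
  assumes L: "\<Lambda> > 1" and M: "\<And>k. k \<in> {1..n} \<Longrightarrow> (M k :: real) \<ge> 0"
    and st: "0 \<le> s" "s < t" "t < 1"
  shows "\<Lambda> * (1 - \<Lambda> * t) / (\<Lambda> - t) - (\<Sum>k=1..n. t ^ k * (M k / (1 - t\<^sup>2) + real k * M k))
       < \<Lambda> * (1 - \<Lambda> * s) / (\<Lambda> - s) - (\<Sum>k=1..n. s ^ k * (M k / (1 - s\<^sup>2) + real k * M k))"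
proof -
  have "(1 - \<Lambda> * t) * (\<Lambda> - s) < (1 - \<Lambda> * s) * (\<Lambda> - t)"
  proof -
    have "0 < (t - s) * (\<Lambda>\<^sup>2 - 1)" using st L by (intro mult_pos_pos) auto
    then show ?thesis by (simp add: algebra_simps power2_eq_square)
  qed
  then have "(1 - \<Lambda> * t) / (\<Lambda> - t) < (1 - \<Lambda> * s) / (\<Lambda> - s)"
    using st L by (simp add: divide_less_eq less_divide_eq field_simps)
  then have "\<Lambda> * ((1 - \<Lambda> * t) / (\<Lambda> - t)) < \<Lambda> * ((1 - \<Lambda> * s) / (\<Lambda> - s))"
    using L by (intro mult_strict_left_mono) auto
  moreover have "(\<Sum>k=1..n. s ^ k * (M k / (1 - s\<^sup>2) + real k * M k))
      \<le> (\<Sum>k=1..n. t ^ k * (M k / (1 - t\<^sup>2) + real k * M k))"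
  proof (rule sum_mono)
    fix k assume k: "k \<in> {1..n}"
    have sq: "s\<^sup>2 \<le> t\<^sup>2" "t\<^sup>2 < 1" "s\<^sup>2 < 1"
      using st by (auto simp: power_mono abs_square_less_1)
    then show "s ^ k * (M k / (1 - s\<^sup>2) + real k * M k) \<le> t ^ k * (M k / (1 - t\<^sup>2) + real k * M k)"
      using st M[OF k] by (intro mult_mono power_mono add_mono divide_left_mono add_nonneg_nonneg mult_pos_pos) auto
  qed
  ultimately show ?thesis by simp
qed

text \<open>Existence is the intermediate value theorem, uniqueness is strict monotonicity. This
  gives the description by \<open>THE\<close> in the theorem its meaning.\<close>

lemma radius_ex1:
  assumes L: "\<Lambda> > 1" and M: "\<And>k. k \<in> {1..n} \<Longrightarrow> (M k :: real) \<ge> 0"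
  shows "\<exists>!r. r \<in> {0<..<1} \<and> \<Lambda> * (1 - \<Lambda> * r) / (\<Lambda> - r) -
           (\<Sum>k=1..n. r ^ k * (M k / (1 - r\<^sup>2) + real k * M k)) = 0"
proof -
  define \<phi> where "\<phi> r = \<Lambda> * (1 - \<Lambda> * r) / (\<Lambda> - r) -
           (\<Sum>k=1..n. r ^ k * (M k / (1 - r\<^sup>2) + real k * M k))" for r
  have dec: "\<phi> t < \<phi> s" if "0 \<le> s" "s < t" "t < 1" for s t
    unfolding \<phi>_def using radius_function_strict_antimono[of \<Lambda> n M, OF L M that] .
  \<comment> \<open>The first term vanishes at \<open>b\<close>, so only minus a nonnegative sum
    remains there; no denominator vanishes on \<open>{0..b}\<close>.\<close>
  define b where "b = 1 / \<Lambda>"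
  have b: "0 < b" "b < 1" using L by (auto simp: b_def)
  have "\<phi> b \<le> 0"
  proof -
    have "b\<^sup>2 < 1" using b by (simp add: abs_square_less_1)
    then have "0 \<le> (\<Sum>k=1..n. b ^ k * (M k / (1 - b\<^sup>2) + real k * M k))"
      using M b by (intro sum_nonneg mult_nonneg_nonneg add_nonneg_nonneg) auto
    moreover have "\<Lambda> * (1 - \<Lambda> * b) / (\<Lambda> - b) = 0" using L by (simp add: b_def)
    ultimately show ?thesis unfolding \<phi>_def by linarith
  qed
  have phi0: "\<phi> 0 = 1"
  proof -
    have "(\<Sum>k=1..n. 0 ^ k * (M k / (1 - 0\<^sup>2) + real k * M k)) = 0"
      by (intro sum.neutral) auto
    then show ?thesis using L by (simp add: \<phi>_def)
  qed
  have "continuous_on {0..b} \<phi>"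
    unfolding \<phi>_def
  proof (intro continuous_intros ballI)
    fix r assume "r \<in> {0..b}"
    then have "0 \<le> r" "r < 1" using b by auto
    then show "\<Lambda> - r \<noteq> 0" "1 - r\<^sup>2 \<noteq> 0"
      using L abs_square_less_1[of r] by auto
  qed
  then obtain r where r: "0 \<le> r" "r \<le> b" "\<phi> r = 0"
    using IVT2'[of \<phi> b 0 0] phi0 \<open>\<phi> b \<le> 0\<close> b by auto
  then have "r \<in> {0<..<1}" using phi0 b by (cases "r = 0") auto
  moreover have "s = r" if "s \<in> {0<..<1}" "\<phi> s = 0" for s
    using dec[of s r] dec[of r s] that r \<open>r \<in> {0<..<1}\<close> by (cases s r rule: linorder_cases) auto
  ultimately show ?thesis using r unfolding \<phi>_def by blast
qed

section \<open>The bi-Lipschitz estimate for \<open>F\<close>\<close>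

theorem theorem4p1:
  fixes m :: nat and M :: "nat \<Rightarrow> real" and \<Lambda> r1 \<rho>1 :: real
    and f :: "nat \<Rightarrow> complex \<Rightarrow> complex" and F :: "complex \<Rightarrow> complex"
  assumes "m \<ge> 1"
    and "\<And>k. k \<in> {1..m-1} \<Longrightarrow> M k \<ge> 0"
    and "polyanalytic_on m (ball 0 1) F"
    and "\<And>z. z \<in> ball 0 1 \<Longrightarrow> F z = (\<Sum>k=0..m-1. cnj z ^ k * f k z)"
    and "\<And>k. k \<in> {0..m-1} \<Longrightarrow> f k holomorphic_on ball 0 1"
    and "\<And>k. k \<in> {0..m-1} \<Longrightarrow> f k 0 = 0"
    and "wirtinger_z F 0 = 1"
    and "\<And>z. z \<in> ball 0 1 \<Longrightarrow> norm (deriv (f 0) z) < \<Lambda>"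
    and "\<And>k z. k \<in> {1..m-1} \<Longrightarrow> z \<in> ball 0 1 \<Longrightarrow> norm (f k z) \<le> M k"
    and "r1 = (THE r. r \<in> {0<..<1} \<and>
           \<Lambda> * (1 - \<Lambda> * r) / (\<Lambda> - r) -
           (\<Sum>k=1..m-1. r ^ k * (M k / (1 - r\<^sup>2) + real k * M k)) = 0)"
    and "\<rho>1 \<in> {0<..<r1}"
  shows "bi_lipschitz_on (cball 0 \<rho>1) F"
proof -
  note M = assms(2) and F = assms(4) and hol = assms(5) and f0 = assms(6)
    and lam = assms(8) and fM = assms(9)
  have idx: "{0..m-1} = {..<m}" using assms(1) by auto
  \<comment> \<open>At 0 the coefficient of \<open>cnj h\<close> in the derivative of
    \<open>F\<close> vanishes because every \<open>f k 0 = 0\<close>, and only \<open>k = 0\<close>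
    contributes to the coefficient of \<open>h\<close>. So the normalisation of \<open>F\<close>
    becomes one of \<open>f 0\<close>.\<close>
  have deriv0: "deriv (f 0) 0 = 1"
  proof -
    have "(\<Sum>k<m. of_nat k * cnj 0 ^ (k - 1) * f k 0) = 0"
      using f0 by (intro sum.neutral) (auto simp: idx)
    moreover have "(\<Sum>k<m. cnj 0 ^ k * deriv (f k) 0) = deriv (f 0) 0"
      using assms(1) by (subst sum.remove[of _ 0]) (auto intro!: sum.neutral)
    ultimately have "((\<lambda>z. \<Sum>k<m. cnj z ^ k * f k z) has_derivative (\<lambda>h. deriv (f 0) 0 * h)) (at 0)"
      using has_derivative_expansion[of "ball 0 1" 0 m f] hol by (simp add: idx)
    then have "frechet_derivative F (at 0) = (\<lambda>h. deriv (f 0) 0 * h)"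
      by (intro frechet_derivative_eqI(2)[of "ball 0 1"]) (use F[unfolded idx] in auto)
    with assms(7) show ?thesis by (simp add: wirtinger_z_def algebra_simps)
  qed
  have L: "\<Lambda> > 1" using lam[of 0] by (simp add: deriv0)
  have r1: "r1 \<in> {0<..<1}" "\<Lambda> * (1 - \<Lambda> * r1) / (\<Lambda> - r1) -
           (\<Sum>k=1..m-1. r1 ^ k * (M k / (1 - r1\<^sup>2) + real k * M k)) = 0"
    using theI'[OF radius_ex1[of \<Lambda> "m - 1" M, OF L M], folded assms(10)] by blast+
  have \<rho>: "0 < \<rho>1" "\<rho>1 < 1" using assms(11) r1 by auto
  \<comment> \<open>\<open>c\<close> will be the expansion factor of \<open>f 0\<close> and
    \<open>B\<close> the Lipschitz constant of the remaining terms \<open>H\<close>;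
    \<open>c - B\<close> is the radius function at \<open>\<rho>1\<close>.\<close>
  define c where "c = \<Lambda> * (1 - \<Lambda> * \<rho>1) / (\<Lambda> - \<rho>1)"
  define B where "B = (\<Sum>k=1..m-1. \<rho>1 ^ k * (M k / (1 - \<rho>1\<^sup>2) + real k * M k))"
  have cB: "c - B > 0"
    using radius_function_strict_antimono[of \<Lambda> "m - 1" M \<rho>1 r1, OF L M] r1 assms(11)
    unfolding c_def B_def by auto
  have B0: "B \<ge> 0"
    unfolding B_def using M \<rho> abs_square_less_1[of \<rho>1]
    by (intro sum_nonneg mult_nonneg_nonneg add_nonneg_nonneg) auto
  let ?D = "cball (0::complex) \<rho>1"
  have D: "z \<in> ball 0 1" if "z \<in> ?D" for z using that \<rho> by auto
  define f' where "f' k z = deriv (f k) z" for k z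
  have df: "(f k has_field_derivative f' k z) (at z)" if "k \<in> {0..m-1}" "z \<in> ball 0 1" for k z
    unfolding f'_def using holomorphic_derivI[OF hol] that by auto
  define H where "H z = (\<Sum>k=1..m-1. cnj z ^ k * f k z)" for z
  \<comment> \<open>The derivative is only real linear: each summand has a part in \<open>h\<close>
    and a part in \<open>cnj h\<close>. Its operator norm is therefore what has to be
    bounded.\<close>
  define H' where "H' z h = (\<Sum>k=1..m-1. cnj z ^ k * (f' k z * h) + (of_nat k * cnj h * cnj z ^ (k - 1)) * f k z)"
    for z h
  have dH: "(H has_derivative H' z) (at z within ?D)" if "z \<in> ?D" for z
  proof -
    have c: "(cnj has_derivative cnj) (at z within ?D)"
      using bounded_linear_imp_has_derivative[OF bounded_linear_cnj] .
    have "(f k has_derivative (\<lambda>h. f' k z * h)) (at z within ?D)" if "k \<in> {1..m-1}" for k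
      using has_derivative_at_withinI df[of k z] that D[OF \<open>z \<in> ?D\<close>]
      by (auto simp: has_field_derivative_def)
    then show ?thesis
      unfolding H_def[abs_def] H'_def[abs_def]
      by (intro has_derivative_sum has_derivative_mult has_derivative_power c) auto
  qed
  have bH: "onorm (H' z) \<le> B" if z: "z \<in> ?D" for z
  proof (rule onorm_bound[OF B0])
    fix h
    have nz: "norm z \<le> \<rho>1" "norm z < 1" using z \<rho> by auto
    have "norm (H' z h) \<le> (\<Sum>k=1..m-1. \<rho>1 ^ k * (M k / (1 - \<rho>1\<^sup>2) + real k * M k) * norm h)"
      unfolding H'_def
    proof (intro sum_norm_le)
      fix k assume k: "k \<in> {1..m-1}"
      then have k0: "k \<in> {0..m-1}" by auto
      \<comment> \<open>The factor gained from Schwarz raises \<open>\<rho>1 ^ (k - 1)\<close>,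
        which comes from differentiating \<open>cnj z ^ k\<close>, to the power
        \<open>\<rho>1 ^ k\<close> in the radius equation.\<close>
      have "norm (f k z) \<le> M k * norm z"
        using Schwarz_Lemma_bound[OF hol[OF k0] f0[OF k0] fM[OF k] nz(2)] by blast
      also have "\<dots> \<le> M k * \<rho>1" using M[OF k] nz by (intro mult_left_mono) auto
      finally have fk: "norm (f k z) \<le> M k * \<rho>1" .
      have "norm (f' k z) \<le> M k / (1 - (norm z)\<^sup>2)"
        unfolding f'_def using Schwarz_Pick_deriv_bound[OF hol[OF k0] fM[OF k] nz(2)] by blast
      also have "\<dots> \<le> M k / (1 - \<rho>1\<^sup>2)"
        using M[OF k] nz \<rho> abs_square_less_1[of \<rho>1]
        by (intro divide_left_mono) (auto simp: power_mono abs_square_less_1)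
      finally have f'k: "norm (f' k z) \<le> M k / (1 - \<rho>1\<^sup>2)" .
      have "norm (cnj z ^ k * (f' k z * h) + (of_nat k * cnj h * cnj z ^ (k - 1)) * f k z)
        \<le> norm z ^ k * (norm (f' k z) * norm h) + (real k * norm h * norm z ^ (k - 1)) * norm (f k z)"
        by (rule order_trans[OF norm_triangle_ineq]) (simp add: norm_mult norm_power)
      also have "\<dots> \<le> \<rho>1 ^ k * (M k / (1 - \<rho>1\<^sup>2) * norm h) + (real k * norm h * \<rho>1 ^ (k - 1)) * (M k * \<rho>1)"
        using nz fk f'k \<rho> order_trans[OF norm_ge_zero f'k]
        by (intro add_mono mult_mono power_mono) auto
      also have "\<dots> = \<rho>1 ^ k * (M k / (1 - \<rho>1\<^sup>2) + real k * M k) * norm h"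
        using k by (cases k) (auto simp: algebra_simps)
      finally show "norm (cnj z ^ k * (f' k z * h) + (of_nat k * cnj h * cnj z ^ (k - 1)) * f k z)
        \<le> \<rho>1 ^ k * (M k / (1 - \<rho>1\<^sup>2) + real k * M k) * norm h" .
    qed
    then show "norm (H' z h) \<le> B * norm h" by (simp add: B_def sum_distrib_right)
  qed
  have lipH: "norm (H z1 - H z2) \<le> B * norm (z1 - z2)" if "z1 \<in> ?D" "z2 \<in> ?D" for z1 z2
    using differentiable_bound[OF convex_cball dH bH that] .
  have df0: "(f 0 has_field_derivative f' 0 z) (at z within ?D)" if "z \<in> ?D" for z
    using df[of 0 z] D[OF that] by (auto intro: has_field_derivative_at_within)
  have up: "norm (f 0 z1 - f 0 z2) \<le> \<Lambda> * norm (z1 - z2)" if "z1 \<in> ?D" "z2 \<in> ?D" for z1 z2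
    using field_differentiable_bound[OF convex_cball df0 _ that] lam D
    by (auto simp: f'_def intro: less_imp_le)
  have low: "c * norm (z1 - z2) \<le> norm (f 0 z1 - f 0 z2)" if "z1 \<in> ?D" "z2 \<in> ?D" for z1 z2
  proof (rule norm_diff_ge_of_Re_deriv_ge[OF convex_cball df0 _ that])
    fix z assume "z \<in> ?D"
    then show "c \<le> Re (f' 0 z)"
      unfolding c_def f'_def using hol[of 0] lam deriv0 \<rho>
      by (intro Re_ge_of_Schwarz_Pick holomorphic_deriv) auto
  qed
  have FH: "F z = f 0 z + H z" if "z \<in> ?D" for z
    using F[OF D[OF that]] by (simp add: H_def sum.atLeast_Suc_atMost)
  show ?thesis unfolding bi_lipschitz_on_def
  \<comment> \<open>Both constants come from the splitting \<open>F = f 0 + H\<close>: the triangle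
    inequality gives the upper one, its reverse form the lower one.\<close>
  proof (rule exI[of _ "c - B"], rule exI[of _ "\<Lambda> + B"], intro conjI ballI)
    fix z1 z2 assume z: "z1 \<in> ?D" "z2 \<in> ?D"
    have eq: "F z1 - F z2 = (f 0 z1 - f 0 z2) + (H z1 - H z2)" using FH z by simp
    show "norm (F z1 - F z2) \<le> (\<Lambda> + B) * norm (z1 - z2)"
      unfolding eq using norm_triangle_ineq[of "f 0 z1 - f 0 z2" "H z1 - H z2"] up[OF z] lipH[OF z]
      by (simp add: distrib_right)
    show "(c - B) * norm (z1 - z2) \<le> norm (F z1 - F z2)"
      unfolding eq using norm_diff_ineq[of "f 0 z1 - f 0 z2" "H z1 - H z2"] low[OF z] lipH[OF z]
      by (simp add: left_diff_distrib)
  qed (use cB L B0 in auto)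
qed

end
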